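(* Let $\mathcal S=\{S_1,\dots,S_k\}$ be a set of strings, let $n$ be the maximum and $l$ the minimum of their lengths, and let $\|\mathcal S\|=\sum_i|S_i|$. \textsc{MCS Enumeration} (outputting all maximal common subsequences of $\mathcal S$) can be solved in $\mathsf{FPT}$ total time with respect to the parameter $l$, i.e. in total time $f(l)\cdot \mathrm{poly}(\|\mathcal S\|)$ for some computable $f$. Specifically, when $l$ is logarithmic in $\|\mathcal S\|$ (i.e. $l\le c\log\|\mathcal S\|$ for a constant $c$), all MCSs can be enumerated in time polynomial in $n$ and $k$, and when $l$ is polylogarithmic in $\|\mathcal S\|$ (i.e. $l\le c\log^d\|\mathcal S\|$ for constants $c,d$), all MCSs can be enumerated in time quasi-polynomial in $n$ and $k$.
   Context: A string $Y$ is a subsequence of $X$ if $Y$ is obtained from $X$ by deleting zero or more characters. A maximal common subsequence (MCS) of $\mathcal S$ is a string that is a subsequence of every $S_i$ and is not a proper subsequence of any other common subsequence of $\mathcal S$. Quasi-polynomial time in a quantity $N$ means time $N^{\mathrm{poly}(\log N)}$. *)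

theory Defs
  imports Complex_Main "HOL-Library.Sublist" "HOL-Computational_Algebra.Polynomial"
begin

section \<open>Maximal common subsequences\<close>

text \<open>Characters are natural numbers, so the alphabet is unbounded.\<close>

type_synonym str = "nat list"

definition common_subseqs :: "str set \<Rightarrow> str set" where
  "common_subseqs S = {w. \<forall>s\<in>S. subseq w s}"

definition MCS :: "str set \<Rightarrow> str set" where
  "MCS S = {w \<in> common_subseqs S. \<not> (\<exists>v\<in>common_subseqs S. strict_subseq w v)}"

definition max_len :: "str set \<Rightarrow> nat" where
  "max_len S = Max (length ` S)"

definition min_len :: "str set \<Rightarrow> nat" where
  "min_len S = Min (length ` S)"

definition total_len :: "str set \<Rightarrow> nat" where
  "total_len S = (\<Sum>s\<in>S. length s)"

section \<open>A random access machine\<close>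

text \<open>
  Programs of a random access machine with structured control flow and uniform cost. Memory is
  divided into arrays of natural numbers; the array is named by a literal of the program and only
  the index is computed, so a program uses finitely many arrays, and cell 0 of an array
  can serve as a register. The arithmetic operations are addition and truncated subtraction. There
  is no multiplication, so one step lengthens the largest number in binary by at most one bit and
  the uniform cost measure is polynomially related to Turing machine time for numbers of
  polynomially many bits.
\<close>

datatype expr =
    Num nat
  | Get nat expr
  | Plus expr expr
  | Minus expr expr
  | Less expr expr
  | Equal expr expr

datatype cmd =
    Skip
  | Put nat expr expr
  | Out expr
  | Seq cmd cmd
  | If expr cmd cmd
  | While expr cmd

type_synonym memory = "nat \<Rightarrow> nat \<Rightarrow> nat"

fun eval :: "memory \<Rightarrow> expr \<Rightarrow> nat" where
  "eval m (Num i) = i"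
| "eval m (Get a e) = m a (eval m e)"
| "eval m (Plus e1 e2) = eval m e1 + eval m e2"
| "eval m (Minus e1 e2) = eval m e1 - eval m e2"
| "eval m (Less e1 e2) = (if eval m e1 < eval m e2 then 1 else 0)"
| "eval m (Equal e1 e2) = (if eval m e1 = eval m e2 then 1 else 0)"

fun cost :: "expr \<Rightarrow> nat" where
  "cost (Num i) = 1"
| "cost (Get a e) = cost e + 1"
| "cost (Plus e1 e2) = cost e1 + cost e2 + 1"
| "cost (Minus e1 e2) = cost e1 + cost e2 + 1"
| "cost (Less e1 e2) = cost e1 + cost e2 + 1"
| "cost (Equal e1 e2) = cost e1 + cost e2 + 1"

text \<open>
  A configuration consists of the memory and of the output written so far. In
  \<open>exec c s t s'\<close>, the number \<open>t\<close> is the running time of the command \<open>c\<close> started in \<open>s\<close>.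
  Conditions are true when nonzero.
\<close>

inductive exec :: "cmd \<Rightarrow> memory \<times> nat list \<Rightarrow> nat \<Rightarrow> memory \<times> nat list \<Rightarrow> bool" where
  Skip: "exec Skip s 1 s"
| Put: "exec (Put a i e) (m, out) (cost i + cost e + 1)
    (m(a := (m a)(eval m i := eval m e)), out)"
| Out: "exec (Out e) (m, out) (cost e + 1) (m, out @ [eval m e])"
| Seq: "exec c1 s t1 s' \<Longrightarrow> exec c2 s' t2 s'' \<Longrightarrow> exec (Seq c1 c2) s (t1 + t2) s''"
| IfTrue: "eval (fst s) b \<noteq> 0 \<Longrightarrow> exec c1 s t s' \<Longrightarrow>
    exec (If b c1 c2) s (cost b + t + 1) s'"
| IfFalse: "eval (fst s) b = 0 \<Longrightarrow> exec c2 s t s' \<Longrightarrow>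
    exec (If b c1 c2) s (cost b + t + 1) s'"
| WhileFalse: "eval (fst s) b = 0 \<Longrightarrow> exec (While b c) s (cost b + 1) s"
| WhileTrue: "eval (fst s) b \<noteq> 0 \<Longrightarrow> exec c s t1 s' \<Longrightarrow> exec (While b c) s' t2 s'' \<Longrightarrow>
    exec (While b c) s (cost b + 1 + t1 + t2) s''"

lemma exec_deterministic:
  "exec c s t s' \<Longrightarrow> exec c s u s'' \<Longrightarrow> t = u \<and> s' = s''"
proof (induction arbitrary: u s'' rule: exec.induct)
  case (Skip s)
  then show ?case by (cases rule: exec.cases) simp_all
next
  case (Put a i e m out)
  then show ?case by (cases rule: exec.cases) simp_all
next
  case (Out e m out)
  then show ?case by (cases rule: exec.cases) simp_all
next
  case (Seq c1 s t1 s1 c2 t2 s2)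
  from Seq.prems obtain u1 r u2 where "exec c1 s u1 r" "exec c2 r u2 s''" "u = u1 + u2"
    by (cases rule: exec.cases) simp_all
  with Seq.IH show ?case by blast
next
  case (IfTrue s b c1 t s' c2)
  from IfTrue.prems IfTrue.hyps obtain v where "exec c1 s v s''" "u = cost b + v + 1"
    by (cases rule: exec.cases) simp_all
  with IfTrue.IH show ?case by blast
next
  case (IfFalse s b c2 t s' c1)
  from IfFalse.prems IfFalse.hyps obtain v where "exec c2 s v s''" "u = cost b + v + 1"
    by (cases rule: exec.cases) simp_all
  with IfFalse.IH show ?case by blast
next
  case (WhileFalse s b c)
  from WhileFalse.prems WhileFalse.hyps show ?case by (cases rule: exec.cases) simp_all
next
  case (WhileTrue s b c t1 s1 t2 s2)
  from WhileTrue.prems WhileTrue.hyps obtain u1 r u2 where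
    "exec c s u1 r" "exec (While b c) r u2 s''" "u = cost b + 1 + u1 + u2"
    by (cases rule: exec.cases) simp_all
  with WhileTrue.IH show ?case by blast
qed

text \<open>The input is placed in array 0 from index 0 on. All other cells are initially 0.\<close>

definition initial_memory :: "nat list \<Rightarrow> memory" where
  "initial_memory xs = (\<lambda>a i. if a = 0 \<and> i < length xs then xs ! i else 0)"

definition runs :: "cmd \<Rightarrow> nat list \<Rightarrow> nat \<Rightarrow> nat list \<Rightarrow> bool" where
  "runs P xs t out \<longleftrightarrow> (\<exists>m. exec P (initial_memory xs, []) t (m, out))"

definition computable :: "(nat \<Rightarrow> nat) \<Rightarrow> bool" where
  "computable f \<longleftrightarrow> (\<exists>P. \<forall>x. \<exists>t. runs P [x] t [f x])"

section \<open>Enumeration of maximal common subsequences\<close>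

text \<open>
  Strings are written with their length in front, so a list of strings is determined
  by its encoding. The input is preceded by the number of strings; the output is not, because an
  enumerator need not know in advance how many solutions there are.
\<close>

definition encode_strs :: "str list \<Rightarrow> nat list" where
  "encode_strs ss = concat (map (\<lambda>s. length s # s) ss)"

definition encode_instance :: "str list \<Rightarrow> nat list" where
  "encode_instance ss = length ss # encode_strs ss"

text \<open>
  On every listing of the instance, the program halts in total time at most \<open>b\<close>, having output each
  maximal common subsequence exactly once, in any order.
\<close>

definition enumerates_MCS_within :: "cmd \<Rightarrow> str set \<Rightarrow> real \<Rightarrow> bool" where
  "enumerates_MCS_within P S b \<longleftrightarrow>
    (\<forall>ss. distinct ss \<and> set ss = S \<longrightarrow>
      (\<exists>t ws. runs P (encode_instance ss) t (encode_strs ws) \<and> real t \<le> b \<and>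
        distinct ws \<and> set ws = MCS S))"

end

theory Submission
  imports Defs
begin

text \<open>
  Let \<open>s\<close> be a shortest string, of length \<open>l\<close>. The program runs through the \<open>2 ^ l\<close> sets of
  positions of \<open>s\<close> by counting in binary, and outputs the word selected by a set if the set is the
  leftmost embedding of that word (so that no word is output twice), the word is a subsequence
  of all strings, and no insertion of one character of \<open>s\<close> leaves it a common subsequence. Single
  insertions suffice, because every proper supersequence of a word \<open>w\<close> contains \<open>w\<close> with
  one character inserted. One round takes polynomial time, as the number of iterations of each inner
  loop is at most the length of the input. If \<open>l\<close> is logarithmic (polylogarithmic), then
  \<open>2 ^ l\<close> is polynomial (quasi-polynomial).
\<close>

section \<open>Total correctness with running times\<close>

text \<open>Time bounds come in two strengths. Every loop but the main one makes at most
  \<open>N\<close> rounds, where \<open>N\<close> is the length of the encoded input, so its cost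
  can be read off from the program text: \<open>wp\<close> charges \<open>loop_cost N c\<close>, and
  the correctness proofs of the subroutines contain no time arithmetic. The main loop makes
  \<open>2 ^ l\<close> rounds, which no polynomial in \<open>N\<close> bounds in general; for it the
  explicit bound of \<open>wpT\<close> is needed. The three parameter regimes then concern one
  program and one bound, \<open>2 ^ l\<close> times a polynomial in the total length, and differ
  only in the estimate of \<open>2 ^ l\<close>. The machine shapes the programs: without
  multiplication or bit operations, the set of positions is kept as an array of bits and
  \<open>2 ^ l\<close> is obtained by doubling.\<close>

definition wpT :: "nat \<Rightarrow> cmd \<Rightarrow> (memory \<Rightarrow> nat list \<Rightarrow> bool) \<Rightarrow> memory \<Rightarrow> nat list \<Rightarrow> bool" where
  "wpT T c Q m out \<longleftrightarrow> (\<exists>t m' out'. exec c (m, out) t (m', out') \<and> t \<le> T \<and> Q m' out')"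

text \<open>An upper bound for the running time, provided that every loop iterates at most \<open>N\<close> times.\<close>

fun loop_cost :: "nat \<Rightarrow> cmd \<Rightarrow> nat" where
  "loop_cost N Skip = 1"
| "loop_cost N (Put a i e) = cost i + cost e + 1"
| "loop_cost N (Out e) = cost e + 1"
| "loop_cost N (Seq c1 c2) = loop_cost N c1 + loop_cost N c2"
| "loop_cost N (If b c1 c2) = cost b + (loop_cost N c1 + loop_cost N c2) + 1"
| "loop_cost N (While b c) = N * (cost b + 1 + loop_cost N c) + cost b + 1"

definition wp :: "nat \<Rightarrow> cmd \<Rightarrow> (memory \<Rightarrow> nat list \<Rightarrow> bool) \<Rightarrow> memory \<Rightarrow> nat list \<Rightarrow> bool" where
  "wp N c = wpT (loop_cost N c) c"

text \<open>Each level of nested \<open>While\<close> contributes one factor \<open>N\<close>, and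
  everything else adds constants. The polynomial depends on the command alone.\<close>

lemma loop_cost_poly: "\<exists>p. \<forall>N. loop_cost N c = poly p N"
proof (induction c)
  case Skip
  show ?case by (intro exI[of _ 1]) simp
next
  case (Put a i e)
  show ?case by (intro exI[of _ "[:cost i + cost e + 1:]"]) simp
next
  case (Out e)
  show ?case by (intro exI[of _ "[:cost e + 1:]"]) simp
next
  case (Seq c1 c2)
  then obtain p q where "\<forall>N. loop_cost N c1 = poly p N" "\<forall>N. loop_cost N c2 = poly q N" by blast
  then show ?case by (intro exI[of _ "p + q"]) simp
next
  case (If b c1 c2)
  then obtain p q where "\<forall>N. loop_cost N c1 = poly p N" "\<forall>N. loop_cost N c2 = poly q N" by blast
  then show ?case by (intro exI[of _ "[:cost b + 1:] + (p + q)"]) simp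
next
  case (While b c)
  then obtain p where "\<forall>N. loop_cost N c = poly p N" by blast
  then show ?case
    by (intro exI[of _ "[:0, 1:] * ([:cost b + 1:] + p) + [:cost b + 1:]"]) simp
qed

lemma wpT_mono:
  assumes "wpT T c Q m out" "T \<le> T'" "\<And>m' out'. Q m' out' \<Longrightarrow> R m' out'"
  shows "wpT T' c R m out"
  using assms unfolding wp_def wpT_def by (meson order_trans)

lemma wp_conseq:
  assumes "wp N c Q m out" "\<And>m' out'. Q m' out' \<Longrightarrow> R m' out'"
  shows "wp N c R m out"
  using assms unfolding wp_def by (rule wpT_mono[OF _ order_refl])

lemma wp_Put: "wp N (Put a i e) Q m out \<longleftrightarrow> Q (m(a := (m a)(eval m i := eval m e))) out"
proof
  assume "wp N (Put a i e) Q m out"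
  then show "Q (m(a := (m a)(eval m i := eval m e))) out"
    unfolding wp_def wpT_def by (auto elim: exec.cases)
next
  assume "Q (m(a := (m a)(eval m i := eval m e))) out"
  then show "wp N (Put a i e) Q m out"
    unfolding wp_def wpT_def using exec.Put[of a i e m out] by force
qed

lemma wp_Out: "Q m (out @ [eval m e]) \<Longrightarrow> wp N (Out e) Q m out"
  unfolding wp_def wpT_def using exec.Out[of e m out] by force

lemma wp_Skip: "Q m out \<Longrightarrow> wp N Skip Q m out"
  unfolding wp_def wpT_def using exec.Skip[of "(m, out)"] by force

lemma wpT_Seq:
  assumes "wpT T1 c1 (wpT T2 c2 Q) m out"
  shows "wpT (T1 + T2) (Seq c1 c2) Q m out"
  using assms unfolding wp_def wpT_def by (meson add_mono exec.Seq)

lemma wp_Seq: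
  assumes "wp N c1 (wp N c2 Q) m out"
  shows "wp N (Seq c1 c2) Q m out"
  using wpT_Seq[OF assms[unfolded wp_def]] by (simp add: wp_def)

text \<open>An equivalence, so that rewriting executes straight-line code. The direction from left
  to right holds because an assignment takes exactly the time that \<open>loop_cost\<close> charges
  for it, so the time left for \<open>c\<close> is at most \<open>loop_cost N c\<close>.\<close>

lemma wp_Put_Seq:
  "wp N (Seq (Put a i e) c) Q m out \<longleftrightarrow> wp N c Q (m(a := (m a)(eval m i := eval m e))) out"
proof
  assume "wp N c Q (m(a := (m a)(eval m i := eval m e))) out"
  then show "wp N (Seq (Put a i e) c) Q m out"
    by (intro wp_Seq) (simp only: wp_Put)
next
  assume "wp N (Seq (Put a i e) c) Q m out"
  then obtain t m' out' where t: "exec (Seq (Put a i e) c) (m, out) t (m', out')"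
      "t \<le> loop_cost N (Seq (Put a i e) c)" "Q m' out'"
    unfolding wp_def wpT_def by blast
  from t(1) obtain t1 t2 r where *: "exec (Put a i e) (m, out) t1 r" "exec c r t2 (m', out')"
      "t = t1 + t2"
    by (cases rule: exec.cases) simp_all
  from *(1) have "t1 = cost i + cost e + 1" "r = (m(a := (m a)(eval m i := eval m e)), out)"
    by (cases rule: exec.cases; simp)+
  with * t show "wp N c Q (m(a := (m a)(eval m i := eval m e))) out"
    unfolding wp_def wpT_def by auto
qed

lemma wp_If:
  assumes "eval m b \<noteq> 0 \<Longrightarrow> wp N c1 Q m out" "eval m b = 0 \<Longrightarrow> wp N c2 Q m out"
  shows "wp N (If b c1 c2) Q m out"
proof (cases "eval m b = 0")
  case True
  then obtain t m' out' where "exec c2 (m, out) t (m', out')" "t \<le> loop_cost N c2" "Q m' out'"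
    using assms unfolding wp_def wpT_def by blast
  with True show ?thesis
    unfolding wp_def wpT_def
    using exec.IfFalse[of "(m, out)" b c2 t "(m', out')" c1] by force
next
  case False
  then obtain t m' out' where "exec c1 (m, out) t (m', out')" "t \<le> loop_cost N c1" "Q m' out'"
    using assms unfolding wp_def wpT_def by blast
  with False show ?thesis
    unfolding wp_def wpT_def
    using exec.IfTrue[of "(m, out)" b c1 t "(m', out')" c2] by force
qed

section \<open>Counting loops\<close>

abbreviation Reg :: "nat \<Rightarrow> expr" where
  "Reg a \<equiv> Get a (Num 0)"

abbreviation SetReg :: "nat \<Rightarrow> expr \<Rightarrow> cmd" where
  "SetReg a e \<equiv> Put a (Num 0) e"

text \<open>The bound \<open>e\<close> is evaluated anew before every round; hence the loop rules
  require that the invariant fixes its value.\<close>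

definition For :: "nat \<Rightarrow> expr \<Rightarrow> cmd \<Rightarrow> cmd" where
  "For a e c = Seq (SetReg a (Num 0))
    (While (Less (Reg a) e) (Seq c (SetReg a (Plus (Reg a) (Num 1)))))"

lemma wpT_While_count:
  assumes bound: "\<And>i m out. I i m out \<Longrightarrow> eval m e = n"
    and step: "\<And>i m out. i < n \<Longrightarrow> m a 0 = i \<Longrightarrow> I i m out \<Longrightarrow>
      wpT T c (\<lambda>m' out'. m' a 0 = Suc i \<and> I (Suc i) m' out') m out"
    and "i \<le> n" "m a 0 = i" "I i m out"
  shows "wpT ((n - i) * (cost (Less (Reg a) e) + 1 + T) + cost (Less (Reg a) e) + 1)
    (While (Less (Reg a) e) c) (I n) m out"
  using \<open>i \<le> n\<close> \<open>m a 0 = i\<close> \<open>I i m out\<close>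
proof (induction i arbitrary: m out rule: inc_induct)
  case base
  have "eval m (Less (Reg a) e) = 0"
    using base bound by simp
  then have "exec (While (Less (Reg a) e) c) (m, out) (cost (Less (Reg a) e) + 1) (m, out)"
    by (intro exec.WhileFalse) simp
  with base show ?case
    unfolding wp_def wpT_def by force
next
  case (step j)
  obtain t m' out' where t: "exec c (m, out) t (m', out')" "t \<le> T" "m' a 0 = Suc j"
      "I (Suc j) m' out'"
    using assms(2)[OF \<open>j < n\<close> step.prems] unfolding wp_def wpT_def by blast
  obtain u m'' out'' where u: "exec (While (Less (Reg a) e) c) (m', out') u (m'', out'')"
      "u \<le> (n - Suc j) * (cost (Less (Reg a) e) + 1 + T) + cost (Less (Reg a) e) + 1"
      "I n m'' out''"
    using step.IH[OF t(3,4)] unfolding wp_def wpT_def by blast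
  have "eval m (Less (Reg a) e) \<noteq> 0"
    using step.prems \<open>j < n\<close> bound by simp
  then have "exec (While (Less (Reg a) e) c) (m, out)
      (cost (Less (Reg a) e) + 1 + t + u) (m'', out'')"
    using t u by (intro exec.WhileTrue) simp_all
  moreover have "n - j = Suc (n - Suc j)"
    using \<open>j < n\<close> by simp
  then have "cost (Less (Reg a) e) + 1 + t + u
      \<le> (n - j) * (cost (Less (Reg a) e) + 1 + T) + cost (Less (Reg a) e) + 1"
    using t(2) u(2) by simp
  ultimately show ?case
    using u(3) unfolding wp_def wpT_def by blast
qed

text \<open>A round costs \<open>cost e + 3\<close> for the guard, one unit, the body, and 6 for the
  increment. The final \<open>cost e + 7\<close> consists of 3 for the initial assignment and
  \<open>cost e + 4\<close> for the failing guard with its unit.\<close>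

lemma wpT_For:
  assumes bound: "\<And>i m out. I i m out \<Longrightarrow> eval m e = n"
    and init: "I 0 (m(a := (m a)(0 := 0))) out"
    and step: "\<And>i m out. i < n \<Longrightarrow> m a 0 = i \<Longrightarrow> I i m out \<Longrightarrow>
      wp N c (\<lambda>m' out'. m' a 0 = i \<and> I (Suc i) (m'(a := (m' a)(0 := Suc i))) out') m out"
    and final: "\<And>m out. I n m out \<Longrightarrow> Q m out"
  shows "wpT (n * (cost e + 10 + loop_cost N c) + cost e + 7) (For a e c) Q m out"
proof -
  let ?m = "m(a := (m a)(0 := 0))"
  let ?c = "Seq c (SetReg a (Plus (Reg a) (Num 1)))"
  have body: "wp N ?c (\<lambda>m' out'. m' a 0 = Suc i \<and> I (Suc i) m' out') m out"
    if "i < n" "m a 0 = i" "I i m out" for i m out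
    by (rule wp_Seq, rule wp_conseq[OF step[OF that]]) (simp only: wp_Put, simp)
  have "wpT ((n - 0) * (cost (Less (Reg a) e) + 1 + loop_cost N ?c) + cost (Less (Reg a) e) + 1)
      (While (Less (Reg a) e) ?c) (I n) ?m out"
    by (rule wpT_While_count[of I e n]) (use bound body[unfolded wp_def] init in simp_all)
  then have loop: "wpT ((n - 0) * (cost (Less (Reg a) e) + 1 + loop_cost N ?c)
      + cost (Less (Reg a) e) + 1) (While (Less (Reg a) e) ?c) Q ?m out"
    by (rule wpT_mono) (use final in auto)
  have "wp N (SetReg a (Num 0))
      (wpT ((n - 0) * (cost (Less (Reg a) e) + 1 + loop_cost N ?c)
        + cost (Less (Reg a) e) + 1) (While (Less (Reg a) e) ?c) Q) m out"
    unfolding wp_Put using loop by simp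
  from wpT_Seq[OF this[unfolded wp_def]] have "wpT (n * (cost e + 10 + loop_cost N c) + cost e + 7)
      (For a e c) Q m out"
    unfolding For_def by (rule wpT_mono) (auto simp: algebra_simps)
  then show ?thesis .
qed

text \<open>Replacing the true number of rounds by \<open>N\<close> turns the exact count into the
  bound that \<open>loop_cost\<close> reads off from the syntax.\<close>

lemma wp_For:
  assumes "n \<le> N"
    and bound: "\<And>i m out. I i m out \<Longrightarrow> eval m e = n"
    and init: "I 0 (m(a := (m a)(0 := 0))) out"
    and step: "\<And>i m out. i < n \<Longrightarrow> m a 0 = i \<Longrightarrow> I i m out \<Longrightarrow>
      wp N c (\<lambda>m' out'. m' a 0 = i \<and> I (Suc i) (m'(a := (m' a)(0 := Suc i))) out') m out"
    and final: "\<And>m out. I n m out \<Longrightarrow> Q m out"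
  shows "wp N (For a e c) Q m out"
unfolding wp_def
proof (rule wpT_mono[OF wpT_For[of I e n, OF bound init step final]])
  have "n * (cost e + 10 + loop_cost N c) \<le> N * (cost e + 10 + loop_cost N c)"
    using \<open>n \<le> N\<close> by (rule mult_le_mono1)
  then show "n * (cost e + 10 + loop_cost N c) + cost e + 7 \<le> loop_cost N (For a e c)"
    by (simp add: For_def algebra_simps)
qed

section \<open>Subsequences of a string\<close>

text \<open>One step of the greedy left-to-right matching of \<open>w\<close>, of which \<open>p\<close> characters are matched.\<close>

definition advance :: "str \<Rightarrow> nat \<Rightarrow> nat \<Rightarrow> nat" where
  "advance w p x = (if p < length w \<and> w ! p = x then Suc p else p)"

abbreviation matched :: "str \<Rightarrow> str \<Rightarrow> nat" where
  "matched w s \<equiv> foldl (advance w) 0 s"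

text \<open>Greedy matching loses nothing: when the next character of \<open>w\<close> occurs, using
  it at once is as good as waiting (\<open>subseq_Cons2_iff\<close>). The start \<open>p\<close> is
  arbitrary for the sake of the induction.\<close>

lemma foldl_advance_eq_length:
  "p \<le> length w \<Longrightarrow> foldl (advance w) p s = length w \<longleftrightarrow> subseq (drop p w) s"
proof (induction s arbitrary: p)
  case Nil
  then show ?case by (auto dest: list_emb_length)
next
  case (Cons x s)
  show ?case
  proof (cases "p < length w")
    case True
    then have "drop p w = w ! p # drop (Suc p) w"
      by (simp add: Cons_nth_drop_Suc)
    with True Cons.IH[of p] Cons.IH[of "Suc p"] show ?thesis
      by (simp add: advance_def subseq_Cons2_iff)
  next
    case False
    with Cons Cons.IH[of p] show ?thesis
      by (simp add: advance_def)
  qed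
qed

lemma matched_eq_length: "matched w s = length w \<longleftrightarrow> subseq w s"
  using foldl_advance_eq_length[of 0 w s] by simp

text \<open>These positions form the leftmost embedding into \<open>s\<close> of the longest prefix
  of \<open>w\<close> that embeds at all.\<close>

definition greedy :: "str \<Rightarrow> str \<Rightarrow> nat \<Rightarrow> bool" where
  "greedy w s i \<longleftrightarrow>
    matched w (take i s) < length w \<and> w ! matched w (take i s) = s ! i"

lemma matched_take_Suc:
  "i < length s \<Longrightarrow>
    matched w (take (Suc i) s) = matched w (take i s) + (if greedy w s i then 1 else 0)"
  by (simp add: take_Suc_conv_app_nth greedy_def advance_def)

lemma select_greedy:
  "i \<le> length s \<Longrightarrow>
    map ((!) s) (filter (greedy w s) [0..<i]) = take (matched w (take i s)) w"
proof (induction i)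
  case (Suc i)
  then have IH: "map ((!) s) (filter (greedy w s) [0..<i]) = take (matched w (take i s)) w"
    and step: "matched w (take (Suc i) s) = matched w (take i s) + (if greedy w s i then 1 else 0)"
    by (simp_all add: matched_take_Suc)
  show ?case
  proof (cases "greedy w s i")
    case True
    then have "matched w (take i s) < length w" "w ! matched w (take i s) = s ! i"
      by (simp_all add: greedy_def)
    with True show ?thesis
      unfolding step by (simp add: IH take_Suc_conv_app_nth)
  next
    case False
    then show ?thesis
      unfolding step by (simp add: IH)
  qed
qed simp

text \<open>A number below \<open>2 ^ length s\<close> stands for a set of positions of \<open>s\<close>.\<close>

definition select :: "nat \<Rightarrow> str \<Rightarrow> str" where
  "select x s = map ((!) s) (filter (bit x) [0..<length s])"

text \<open>
  Every subsequence is selected by exactly one canonical number, namely by its leftmost embedding.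
\<close>

definition canonical :: "nat \<Rightarrow> str \<Rightarrow> bool" where
  "canonical x s \<longleftrightarrow> (\<forall>i<length s. bit x i \<longleftrightarrow> greedy (select x s) s i)"

lemma length_select_le: "length (select x s) \<le> length s"
  unfolding select_def using length_filter_le[of "bit x" "[0..<length s]"] by simp

lemma ex_nat_bits: "\<exists>x<2 ^ l. \<forall>i<l. bit (x::nat) i = b i"
proof (intro exI conjI allI impI)
  let ?x = "horner_sum of_bool 2 (map b [0..<l]) :: nat"
  show "?x < 2 ^ l"
    using horner_sum_of_bool_2_less[of "map b [0..<l]"] by (simp del: upt_Suc)
  show "bit ?x i = b i" if "i < l" for i
    using that by (simp add: bit_horner_sum_bit_iff)
qed

lemma nat_bits_eqI:
  fixes x y :: nat
  assumes "x < 2 ^ l" "y < 2 ^ l" "\<And>i. i < l \<Longrightarrow> bit x i = bit y i"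
  shows "x = y"
proof -
  have "take_bit l x = take_bit l y"
    using assms(3) by (auto simp: bit_eq_iff bit_take_bit_iff)
  with assms show ?thesis by (simp add: take_bit_nat_eq_self)
qed

text \<open>The witness has its bits at the positions of the leftmost embedding of \<open>w\<close>.
  These positions spell \<open>w\<close> again, so the witness agrees with the leftmost embedding of
  the word that it selects.\<close>

lemma ex_canonical:
  assumes "subseq w s"
  shows "\<exists>x<2 ^ length s. canonical x s \<and> select x s = w"
proof -
  obtain x :: nat where x: "x < 2 ^ length s" "\<forall>i<length s. bit x i = greedy w s i"
    using ex_nat_bits by blast
  have "filter (bit x) [0..<length s] = filter (greedy w s) [0..<length s]"
    using x(2) by (intro filter_cong) auto
  then have "select x s = take (matched w s) w"
    using select_greedy[of "length s" s w] by (simp add: select_def)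
  also have "\<dots> = w"
    using assms matched_eq_length by (metis order_refl take_all)
  finally show ?thesis
    using x by (auto simp: canonical_def)
qed

text \<open>The bits of a canonical number below \<open>length s\<close> are determined by the
  selected word, and a number below \<open>2 ^ length s\<close> has no others.\<close>

lemma inj_on_select: "inj_on (\<lambda>x. select x s) {x. x < 2 ^ length s \<and> canonical x s}"
proof (rule inj_onI)
  fix x y
  assume "x \<in> {x. x < 2 ^ length s \<and> canonical x s}" "y \<in> {x. x < 2 ^ length s \<and> canonical x s}"
    "select x s = select y s"
  then show "x = y"
    by (intro nat_bits_eqI[of x "length s" y]) (simp_all add: canonical_def)
qed

section \<open>Maximality by single insertions\<close>

definition insert_char :: "nat \<Rightarrow> nat \<Rightarrow> str \<Rightarrow> str" where
  "insert_char g c w = take g w @ c # drop g w"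

lemma length_insert_char: "g \<le> length w \<Longrightarrow> length (insert_char g c w) = Suc (length w)"
  by (simp add: insert_char_def)

lemma subseq_insert_char: "subseq w (insert_char g c w)"
proof -
  have "subseq (take g w @ drop g w) (insert_char g c w)"
    unfolding insert_char_def by (intro list_emb_append_mono) auto
  then show ?thesis by simp
qed

text \<open>As \<open>w \<noteq> v\<close>, the embedding skips some character of \<open>v\<close>.
  At the first skip this character can be inserted into \<open>w\<close> and matched there;
  characters matched before it only shift the gap to the right.\<close>

lemma subseq_insert_charE:
  assumes "subseq w v" "w \<noteq> v"
  shows "\<exists>g\<le>length w. \<exists>c\<in>set v. subseq (insert_char g c w) v"
  using assms
proof (induction rule: list_emb.induct)
  case (list_emb_Nil ys)
  then obtain y zs where "ys = y # zs" by (cases ys) auto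
  then show ?case by (auto simp: insert_char_def)
next
  case (list_emb_Cons xs ys y)
  then show ?case
    by (intro exI[of _ 0]) (auto simp: insert_char_def)
next
  case (list_emb_Cons2 x y xs ys)
  then obtain g c where "g \<le> length xs" "c \<in> set ys" "subseq (insert_char g c xs) ys"
    by auto
  with list_emb_Cons2 show ?case
    by (intro exI[of _ "Suc g"] conjI bexI[of _ c]) (auto simp: insert_char_def)
qed

text \<open>Makes maximality a finite test in spite of the unbounded alphabet: the inserted
  character can be taken from a larger common subsequence, hence it occurs in the fixed string
  \<open>s\<close>.\<close>

lemma MCS_iff_insert_char:
  assumes "s \<in> S"
  shows "w \<in> MCS S \<longleftrightarrow> w \<in> common_subseqs S \<and>
    (\<forall>g\<le>length w. \<forall>j<length s. insert_char g (s ! j) w \<notin> common_subseqs S)"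
proof
  assume w: "w \<in> MCS S"
  have "insert_char g c w \<notin> common_subseqs S" if "g \<le> length w" for g c
  proof -
    have "w \<noteq> insert_char g c w"
      using length_insert_char[OF that, of c] by (metis n_not_Suc_n)
    then have "strict_subseq w (insert_char g c w)"
      using subseq_insert_char by (simp add: strict_subseq_def)
    with w show ?thesis by (auto simp: MCS_def)
  qed
  with w show "w \<in> common_subseqs S \<and>
    (\<forall>g\<le>length w. \<forall>j<length s. insert_char g (s ! j) w \<notin> common_subseqs S)"
    by (simp add: MCS_def)
next
  assume w: "w \<in> common_subseqs S \<and>
    (\<forall>g\<le>length w. \<forall>j<length s. insert_char g (s ! j) w \<notin> common_subseqs S)"
  have False if v: "v \<in> common_subseqs S" "strict_subseq w v" for v
  proof -
    obtain g c where gc: "g \<le> length w" "c \<in> set v" "subseq (insert_char g c w) v"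
      using subseq_insert_charE[of w v] v(2) by (auto simp: strict_subseq_def)
    have "set v \<subseteq> set s"
      using v(1) assms by (auto simp: common_subseqs_def dest: list_emb_set)
    then obtain j where "j < length s" "c = s ! j"
      using gc(2) by (metis in_set_conv_nth subsetD)
    moreover have "insert_char g c w \<in> common_subseqs S"
      using gc(3) v(1) by (auto simp: common_subseqs_def intro: subseq_order.order_trans)
    ultimately show False
      using w gc(1) by blast
  qed
  with w show "w \<in> MCS S" by (auto simp: MCS_def)
qed

section \<open>Canonical numbers of the maximal common subsequences\<close>

definition solution :: "str set \<Rightarrow> str \<Rightarrow> nat \<Rightarrow> bool" where
  "solution S s x \<longleftrightarrow> canonical x s \<and> select x s \<in> MCS S"

lemma solutions_distinct:
  "distinct (map (\<lambda>x. select x s) (filter (solution S s) [0..<2 ^ length s]))"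
  unfolding distinct_map
  by (auto intro: inj_on_subset[OF inj_on_select] simp: solution_def)

lemma solutions_MCS:
  assumes "s \<in> S"
  shows "set (map (\<lambda>x. select x s) (filter (solution S s) [0..<2 ^ length s])) = MCS S"
proof (intro equalityI subsetI)
  fix w assume "w \<in> MCS S"
  moreover from this have "subseq w s"
    using assms by (simp add: MCS_def common_subseqs_def)
  then obtain x where "x < 2 ^ length s" "canonical x s" "select x s = w"
    using ex_canonical by blast
  ultimately show "w \<in> set (map (\<lambda>x. select x s) (filter (solution S s) [0..<2 ^ length s]))"
    by (auto simp: solution_def image_iff)
qed (auto simp: solution_def)

text \<open>Binary addition of one: the carry into place \<open>i\<close> is \<open>2 ^ i dvd Suc x\<close>.\<close>

lemma bit_Suc_carry: "bit (Suc x) i \<longleftrightarrow> bit x i \<noteq> (2 ^ i dvd Suc x)"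
  by (simp add: bit_iff_odd div_Suc mod_eq_0_iff_dvd)

lemma carry_Suc: "2 ^ Suc i dvd Suc x \<longleftrightarrow> bit x i \<and> 2 ^ i dvd Suc x"
proof
  assume *: "2 ^ Suc i dvd Suc x"
  then have "2 ^ i dvd Suc x" by (rule power_le_dvd) simp
  moreover have "\<not> bit (Suc x) i"
    using * by (simp add: bit_iff_odd dvd_mult_imp_div)
  ultimately show "bit x i \<and> 2 ^ i dvd Suc x"
    using bit_Suc_carry by blast
next
  assume *: "bit x i \<and> 2 ^ i dvd Suc x"
  then have "even (Suc x div 2 ^ i)"
    using bit_Suc_carry[of x i] by (simp add: bit_iff_odd)
  with * show "2 ^ Suc i dvd Suc x"
    by (metis dvd_div_iff_mult mult.commute power_Suc power_not_zero zero_neq_numeral)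
qed

section \<open>Programs\<close>

text \<open>Every variable has an array of its own, scalars sitting in cell 0. Frame conditions can
  therefore be stated for whole arrays, and disjointness is a comparison of literals.\<close>

abbreviation (input) "rInput \<equiv> 0 :: nat"
abbreviation (input) "rBest \<equiv> 1 :: nat"
abbreviation (input) "rPos \<equiv> 2 :: nat"
abbreviation (input) "rI \<equiv> 3 :: nat"
abbreviation (input) "rJ \<equiv> 4 :: nat"
abbreviation (input) "rMatch \<equiv> 5 :: nat"
abbreviation (input) "rFlag \<equiv> 6 :: nat"
abbreviation (input) "rLen \<equiv> 7 :: nat"
abbreviation (input) "rPow \<equiv> 8 :: nat"
abbreviation (input) "rMask \<equiv> 9 :: nat"
abbreviation (input) "rWord \<equiv> 10 :: nat"
abbreviation (input) "rSize \<equiv> 11 :: nat"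
abbreviation (input) "rWord' \<equiv> 12 :: nat"
abbreviation (input) "rSize' \<equiv> 13 :: nat"
abbreviation (input) "rGood \<equiv> 14 :: nat"
abbreviation (input) "rGap \<equiv> 15 :: nat"
abbreviation (input) "rChar \<equiv> 16 :: nat"
abbreviation (input) "rTmp \<equiv> 17 :: nat"
abbreviation (input) "rCount \<equiv> 18 :: nat"
abbreviation (input) "rCarry \<equiv> 19 :: nat"

text \<open>Conjunction, valid only for operands that evaluate to 0 or 1. The invariants keep all
  flags in this range.\<close>

abbreviation Both :: "expr \<Rightarrow> expr \<Rightarrow> expr" where
  "Both e1 e2 \<equiv> Equal (Plus e1 e2) (Num 2)"

abbreviation Next :: "expr \<Rightarrow> expr" where
  "Next e \<equiv> Plus e (Num 1)"

text \<open>\<open>rPos\<close> moves along the length cells of the encoded strings. The innermost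
  assignment is \<open>advance\<close> without a branch: the truth value is added to the number of
  matched characters. Once the word is exhausted a cell beyond its end is read, but then the other
  conjunct is 0.\<close>

definition common_test :: "nat \<Rightarrow> nat \<Rightarrow> cmd" where
  "common_test a r =
    Seq (SetReg rPos (Num 1)) (
    Seq (SetReg rFlag (Num 1)) (
    For rI (Reg rInput) (
      Seq (SetReg rMatch (Num 0)) (
      Seq (For rJ (Get rInput (Reg rPos)) (
        SetReg rMatch (Plus (Reg rMatch) (Both
          (Less (Reg rMatch) (Reg r))
          (Equal (Get a (Reg rMatch)) (Get rInput (Plus (Next (Reg rPos)) (Reg rJ)))))))) (
      Seq (SetReg rFlag (Both (Reg rFlag) (Equal (Reg rMatch) (Reg r)))) (
      SetReg rPos (Plus (Next (Reg rPos)) (Get rInput (Reg rPos)))))))))"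

definition find_shortest :: cmd where
  "find_shortest =
    Seq (SetReg rPos (Num 1)) (
    Seq (SetReg rBest (Num 1)) (
    Seq (For rI (Reg rInput) (
      Seq (If (Less (Get rInput (Reg rPos)) (Get rInput (Reg rBest)))
        (SetReg rBest (Reg rPos)) Skip) (
      SetReg rPos (Plus (Next (Reg rPos)) (Get rInput (Reg rPos)))))) (
    SetReg rLen (Get rInput (Reg rBest)))))"

text \<open>Repeated doubling replaces multiplication. The registers are parameters because the same
  code also shows that \<open>2 ^ x\<close> is computable, with the input cell as its
  exponent.\<close>

definition power_two :: "nat \<Rightarrow> nat \<Rightarrow> nat \<Rightarrow> cmd" where
  "power_two i r a = Seq (SetReg a (Num 1)) (For i (Reg r) (SetReg a (Plus (Reg a) (Reg a))))"

abbreviation ShortestChar :: "expr \<Rightarrow> expr" where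
  "ShortestChar e \<equiv> Get rInput (Plus (Next (Reg rBest)) e)"

text \<open>Each character is written just behind the word, and the end moves past it only if the
  mask bit is 1; a rejected character is overwritten or stays beyond the end.\<close>

definition select_word :: cmd where
  "select_word =
    Seq (SetReg rSize (Num 0)) (
    For rI (Reg rLen) (
      Seq (Put rWord (Reg rSize) (ShortestChar (Reg rI))) (
      SetReg rSize (Plus (Reg rSize) (Get rMask (Reg rI))))))"

definition canonical_test :: cmd where
  "canonical_test =
    Seq (SetReg rGood (Num 1)) (
    Seq (SetReg rMatch (Num 0)) (
    For rI (Reg rLen) (
      Seq (SetReg rTmp (Both (Less (Reg rMatch) (Reg rSize))
        (Equal (Get rWord (Reg rMatch)) (ShortestChar (Reg rI))))) (
      Seq (SetReg rGood (Both (Reg rGood) (Equal (Get rMask (Reg rI)) (Reg rTmp)))) (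
      SetReg rMatch (Plus (Reg rMatch) (Reg rTmp)))))))"

text \<open>The test \<open>rGap\<close> \<le> \<open>rI\<close> is expressed as \<open>rGap\<close>
  < \<open>rI\<close> + 1. The result goes to a second buffer, as the original word is needed for
  all other insertions and for the output.\<close>

definition insert_word :: cmd where
  "insert_word =
    Seq (For rI (Reg rSize) (
      Put rWord' (Plus (Reg rI) (Less (Reg rGap) (Next (Reg rI)))) (Get rWord (Reg rI)))) (
    Seq (Put rWord' (Reg rGap) (ShortestChar (Reg rChar))) (
    SetReg rSize' (Next (Reg rSize))))"

definition maximal_test :: cmd where
  "maximal_test =
    For rGap (Next (Reg rSize)) (
    For rChar (Reg rLen) (
      Seq insert_word (
      Seq (common_test rWord' rSize') (
      SetReg rGood (Both (Reg rGood) (Equal (Reg rFlag) (Num 0)))))))"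

definition output_word :: cmd where
  "output_word =
    If (Reg rGood)
      (Seq (Out (Reg rSize)) (For rI (Reg rSize) (Out (Get rWord (Reg rI)))))
      Skip"

text \<open>Ripple-carry increment: bit plus carry lies in {0, 1, 2}, the value 2 produces the next
  carry, and subtracting twice that carry leaves the new bit.\<close>

definition next_mask :: cmd where
  "next_mask =
    Seq (SetReg rCarry (Num 1)) (
    For rI (Reg rLen) (
      Seq (SetReg rTmp (Plus (Get rMask (Reg rI)) (Reg rCarry))) (
      Seq (SetReg rCarry (Equal (Reg rTmp) (Num 2))) (
      Put rMask (Reg rI) (Minus (Reg rTmp) (Plus (Reg rCarry) (Reg rCarry)))))))"

definition enumerate_step :: cmd where
  "enumerate_step =
    Seq select_word (
    Seq canonical_test (
    Seq (common_test rWord rSize) (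
    Seq (SetReg rGood (Both (Reg rGood) (Reg rFlag))) (
    Seq maximal_test (
    Seq output_word
    next_mask)))))"

text \<open>The bracketing separates the preparation, which is charged by \<open>loop_cost\<close>,
  from the main loop, whose rounds are counted exactly.\<close>

definition enumerate_MCS :: cmd where
  "enumerate_MCS =
    Seq (Seq find_shortest (power_two rI rLen rPow))
    (For rCount (Reg rPow) enumerate_step)"

section \<open>Layout of the encoded instance in array 0\<close>

definition offset :: "str list \<Rightarrow> nat \<Rightarrow> nat" where
  "offset ss i = 1 + length (encode_strs (take i ss))"

lemma encode_strs_append: "encode_strs (xs @ ys) = encode_strs xs @ encode_strs ys"
  by (simp add: encode_strs_def)

lemma offset_0: "offset ss 0 = 1"
  by (simp add: offset_def encode_strs_def)

lemma offset_Suc: "i < length ss \<Longrightarrow> offset ss (Suc i) = offset ss i + 1 + length (ss ! i)"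
  by (simp add: offset_def encode_strs_append take_Suc_conv_app_nth) (simp add: encode_strs_def)

lemma length_encode_strs: "length (encode_strs ss) = sum_list (map length ss) + length ss"
  by (induction ss) (simp_all add: encode_strs_def)

text \<open>\<open>offset ss i\<close> is the address of the length cell of string \<open>i\<close>,
  with its characters right behind; cell 0 holds the number of strings.\<close>

definition holds_instance :: "str list \<Rightarrow> (nat \<Rightarrow> nat) \<Rightarrow> bool" where
  "holds_instance ss M \<longleftrightarrow> M 0 = length ss \<and>
    (\<forall>i<length ss. M (offset ss i) = length (ss ! i) \<and>
      (\<forall>j<length (ss ! i). M (offset ss i + 1 + j) = ss ! i ! j))"

lemma holds_instance_initial: "holds_instance ss (initial_memory (encode_instance ss) 0)"
proof -
  have "initial_memory (encode_instance ss) 0 (offset ss i) = length (ss ! i) \<and>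
    (\<forall>j<length (ss ! i).
      initial_memory (encode_instance ss) 0 (offset ss i + 1 + j) = ss ! i ! j)"
    if "i < length ss" for i
  proof -
    have "ss = take i ss @ ss ! i # drop (Suc i) ss"
      using that by (simp add: id_take_nth_drop)
    then have "encode_strs ss = encode_strs (take i ss) @ encode_strs (ss ! i # drop (Suc i) ss)"
      using encode_strs_append by metis
    then have "encode_instance ss = (length ss # encode_strs (take i ss)) @
        length (ss ! i) # ss ! i @ encode_strs (drop (Suc i) ss)"
      by (simp add: encode_instance_def) (simp add: encode_strs_def)
    then show ?thesis
      by (simp add: initial_memory_def offset_def nth_append)
  qed
  then show ?thesis
    by (simp add: holds_instance_def) (simp add: initial_memory_def encode_instance_def)
qed

section \<open>Correctness of the subroutines\<close>

definition word_at :: "memory \<Rightarrow> nat \<Rightarrow> nat \<Rightarrow> str" where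
  "word_at m a r = map (m a) [0..<m r 0]"

lemma length_word_at [simp]: "length (word_at m a r) = m r 0"
  by (simp add: word_at_def)

lemma nth_word_at [simp]: "i < m r 0 \<Longrightarrow> word_at m a r ! i = m a i"
  by (simp add: word_at_def)

lemma advance_word_at:
  "advance (word_at m a r) p x = (if p < m r 0 \<and> m a p = x then Suc p else p)"
  by (auto simp: advance_def)

text \<open>The conditions on \<open>a\<close> and \<open>r\<close> keep the tested word and its
  length out of the registers that the test overwrites, numbered 2 to 6. They admit both buffers,
  for the candidate and for its one-character extensions.\<close>

lemma common_test_correct:
  assumes inst: "holds_instance ss (m rInput)"
    and N: "length ss \<le> N" "\<And>s. s \<in> set ss \<Longrightarrow> length s \<le> N"
    and ar: "6 < a" "6 < r"
  shows "wp N (common_test a r) (\<lambda>m' out'. out' = out \<and>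
      (\<forall>b. b \<notin> {rPos, rI, rJ, rMatch, rFlag} \<longrightarrow> m' b = m b) \<and>
      m' rFlag 0 = (if word_at m a r \<in> common_subseqs (set ss) then 1 else 0)) m out"
proof -
  define w where "w = word_at m a r"
  let ?inv = "\<lambda>i m' out'. out' = out \<and> (\<forall>b. b \<notin> {rPos, rI, rJ, rMatch, rFlag} \<longrightarrow> m' b = m b) \<and>
    m' rPos 0 = offset ss i \<and>
    m' rFlag 0 = (if \<forall>i'<i. subseq w (ss ! i') then 1 else 0)"
  show ?thesis
    unfolding common_test_def
    apply (simp only: wp_Put_Seq)
    apply (rule wp_For[where I = ?inv and n = "length ss"])
    subgoal using N by simp
    subgoal using inst by (simp add: holds_instance_def)
    subgoal by (simp add: offset_0)
    subgoal premises prems for i m1 out1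
    proof -
      have i: "m1 rInput (offset ss i) = length (ss ! i)"
        "\<And>j. j < length (ss ! i) \<Longrightarrow> m1 rInput (offset ss i + 1 + j) = ss ! i ! j"
        "m1 rInput = m rInput" "m1 rPos 0 = offset ss i"
        using inst prems by (simp_all add: holds_instance_def)
      have ar': "m1 a = m a" "m1 r = m r"
        using ar prems by auto
      let ?inv' = "\<lambda>j m' out'. out' = out \<and>
        (\<forall>b. b \<notin> {rJ, rMatch} \<longrightarrow> m' b = m1 b) \<and> m' rMatch 0 = matched w (take j (ss ! i))"
      show ?thesis
        apply (simp only: wp_Put_Seq)
        apply (rule wp_Seq)
        apply (rule wp_For[where I = ?inv' and n = "length (ss ! i)"])
        subgoal using N prems(1) by simp
        subgoal using i by simp
        subgoal using prems by simp
        subgoal premises prems' for j m2 out2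
        proof -
          have "m2 a = m a" "m2 r = m r"
            using prems' ar ar' by auto
          moreover have "m2 rInput = m1 rInput" "m2 rPos = m1 rPos"
            using prems' by auto
          ultimately show ?thesis
            using prems' i ar
            by (simp add: wp_Put take_Suc_conv_app_nth w_def advance_word_at)
        qed
        subgoal premises prems' for m2 out2
        proof -
          have "m2 r = m r"
            using prems' ar ar' by auto
          moreover have "m2 rInput = m1 rInput" "m2 rPos = m1 rPos" "m2 rFlag = m1 rFlag"
            "m2 rI = m1 rI"
            using prems' by auto
          moreover have "m2 rMatch 0 = m r 0 \<longleftrightarrow> subseq w (ss ! i)"
            using prems' matched_eq_length[of w "ss ! i"] by (simp add: w_def)
          ultimately show ?thesis
            using prems prems' i ar
            by (auto simp add: wp_Put_Seq wp_Put offset_Suc less_Suc_eq)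
        qed
        done
    qed
    subgoal for m1 out1
      by (auto simp: common_subseqs_def w_def all_set_conv_all_nth)
    done
qed

lemma find_shortest_correct:
  assumes inst: "holds_instance ss (m rInput)" and "ss \<noteq> []" and N: "length ss \<le> N"
  shows "wp N find_shortest (\<lambda>m' out'. out' = out \<and>
      (\<forall>b. b \<notin> {rPos, rBest, rI, rLen} \<longrightarrow> m' b = m b) \<and>
      (\<exists>i0<length ss. m' rBest 0 = offset ss i0 \<and> m' rLen 0 = length (ss ! i0) \<and>
        (\<forall>i<length ss. length (ss ! i0) \<le> length (ss ! i)))) m out"
proof -
  let ?inv = "\<lambda>i m' out'. out' = out \<and> (\<forall>b. b \<notin> {rPos, rBest, rI} \<longrightarrow> m' b = m b) \<and>
    m' rPos 0 = offset ss i \<and>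
    (\<exists>i0<length ss. m' rBest 0 = offset ss i0 \<and>
        (\<forall>i'<i. length (ss ! i0) \<le> length (ss ! i')))"
  show ?thesis
    unfolding find_shortest_def
    apply (simp only: wp_Put_Seq)
    apply (rule wp_Seq)
    apply (rule wp_For[where I = ?inv and n = "length ss"])
    subgoal using N by simp
    subgoal using inst by (simp add: holds_instance_def)
    subgoal using \<open>ss \<noteq> []\<close> by (auto simp: offset_0 intro!: exI[of _ 0])
    subgoal premises prems for i m1 out1
    proof -
      obtain i0 where i0: "i0 < length ss" "m1 rBest 0 = offset ss i0"
          "\<forall>i'<i. length (ss ! i0) \<le> length (ss ! i')"
        using prems by blast
      have vals: "m1 rInput (offset ss j) = length (ss ! j)" if "j < length ss" for j
        using inst prems that by (simp add: holds_instance_def)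
      show ?thesis
        apply (rule wp_Seq)
        apply (rule wp_If)
        subgoal premises less
        proof -
          have "length (ss ! i) < length (ss ! i0)"
            using less prems i0 vals by (simp split: if_splits)
          then have "\<forall>i'<Suc i. length (ss ! i) \<le> length (ss ! i')"
            using i0(3) by (auto simp: less_Suc_eq intro: less_imp_le less_le_trans)
          then show ?thesis
            using prems vals by (auto simp: wp_Put offset_Suc intro!: exI[of _ i])
        qed
        subgoal premises less
        proof -
          have "length (ss ! i0) \<le> length (ss ! i)"
            using less prems i0 vals by (simp split: if_splits)
          then have "\<forall>i'<Suc i. length (ss ! i0) \<le> length (ss ! i')"
            using i0(3) by (auto simp: less_Suc_eq)
          then show ?thesis
            using prems vals i0
            by (intro wp_Skip) (auto simp: wp_Put offset_Suc intro!: exI[of _ i0])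
        qed
        done
    qed
    subgoal premises prems for m1 out1
      using prems inst by (auto simp: wp_Put holds_instance_def)
    done
qed

lemma power_two_correct:
  assumes "m r 0 \<le> N" "distinct [i, r, a]"
  shows "wp N (power_two i r a) (\<lambda>m' out'. out' = out \<and>
      (\<forall>b. b \<notin> {i, a} \<longrightarrow> m' b = m b) \<and> m' a 0 = 2 ^ m r 0) m out"
proof -
  let ?inv = "\<lambda>n m' out'. out' = out \<and> (\<forall>b. b \<notin> {i, a} \<longrightarrow> m' b = m b) \<and> m' a 0 = 2 ^ n"
  show ?thesis
    unfolding power_two_def
    apply (simp only: wp_Put_Seq)
    apply (rule wp_For[where I = ?inv and n = "m r 0"])
    subgoal using assms by simp
    subgoal using assms by auto
    subgoal using assms by auto
    subgoal using assms by (auto simp: wp_Put)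
    subgoal by simp
    done
qed

lemma output_word_correct:
  assumes "m rGood 0 = (if G then 1 else 0)" "m rSize 0 \<le> N"
  shows "wp N output_word (\<lambda>m' out'. (\<forall>b. b \<noteq> rI \<longrightarrow> m' b = m b) \<and>
    out' = out @ (if G then m rSize 0 # word_at m rWord rSize else [])) m out"
proof (cases G)
  case True
  let ?inv = "\<lambda>i m' out'. (\<forall>b. b \<noteq> rI \<longrightarrow> m' b = m b) \<and>
    out' = out @ m rSize 0 # map (m rWord) [0..<i]"
  show ?thesis
    unfolding output_word_def
    apply (rule wp_If)
    subgoal
      apply (rule wp_Seq)
      apply (rule wp_Out)
      apply (rule wp_For[where I = ?inv and n = "m rSize 0"])
      subgoal using assms by simp
      subgoal by simp
      subgoal by simp
      subgoal by (rule wp_Out) simp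
      subgoal using True by (simp add: word_at_def)
      done
    subgoal using assms True by simp
    done
next
  case False
  with assms show ?thesis
    unfolding output_word_def by (intro wp_If wp_Skip) simp_all
qed

text \<open>Only places below \<open>l\<close> count, so the last increment, to
  \<open>2 ^ l\<close>, may drop its carry.\<close>

definition holds_mask :: "nat \<Rightarrow> nat \<Rightarrow> (nat \<Rightarrow> nat) \<Rightarrow> bool" where
  "holds_mask l x B \<longleftrightarrow> (\<forall>i<l. B i = (if bit x i then 1 else 0))"

text \<open>In round \<open>i\<close> the places below \<open>i\<close> already show
  \<open>Suc x\<close> and the others still show \<open>x\<close>. The carry into place 0 is 1, in
  agreement with \<open>2 ^ 0 dvd Suc x\<close>.\<close>

lemma next_mask_correct:
  assumes mask: "holds_mask (m rLen 0) x (m rMask)" and "m rLen 0 \<le> N"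
  shows "wp N next_mask (\<lambda>m' out'. out' = out \<and>
    (\<forall>b. b \<notin> {rCarry, rI, rTmp, rMask} \<longrightarrow> m' b = m b) \<and>
    holds_mask (m rLen 0) (Suc x) (m' rMask)) m out"
proof -
  let ?inv = "\<lambda>i m' out'. out' = out \<and>
    (\<forall>b. b \<notin> {rCarry, rI, rTmp, rMask} \<longrightarrow> m' b = m b) \<and>
    holds_mask i (Suc x) (m' rMask) \<and> (\<forall>j\<ge>i. m' rMask j = m rMask j) \<and>
    m' rCarry 0 = (if 2 ^ i dvd Suc x then 1 else 0)"
  show ?thesis
    unfolding next_mask_def
    apply (simp only: wp_Put_Seq)
    apply (rule wp_For[where I = ?inv and n = "m rLen 0"])
    subgoal using assms by simp
    subgoal by simp
    subgoal by (simp add: holds_mask_def)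
    subgoal premises prems for i m1 out1
    proof -
      have "m1 rMask i = (if bit x i then 1 else 0)"
        using prems mask by (simp add: holds_mask_def)
      then show ?thesis
        using prems
        by (simp add: wp_Put_Seq wp_Put holds_mask_def less_Suc_eq bit_Suc_carry carry_Suc
            del: power_Suc)
    qed
    subgoal by simp
    done
qed

text \<open>The inequality in \<open>length_less\<close> is strict because
  \<open>maximal_test\<close> visits \<open>Suc (length w)\<close> gaps, and this count must not
  exceed \<open>N\<close>.\<close>

locale MCS_instance =
  fixes ss :: "str list" and M :: "nat \<Rightarrow> nat" and s :: str and best N :: nat
  assumes inst: "holds_instance ss M"
    and s_in: "s \<in> set ss"
    and s_chars: "\<And>i. i < length s \<Longrightarrow> M (best + 1 + i) = s ! i"
    and ss_le: "length ss \<le> N"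
    and length_less: "\<And>s. s \<in> set ss \<Longrightarrow> length s < N"
begin

definition stored :: "memory \<Rightarrow> bool" where
  "stored m \<longleftrightarrow> m rInput = M \<and> m rBest 0 = best \<and> m rLen 0 = length s"

lemma stored_cong:
  "stored m \<Longrightarrow> m' rInput = m rInput \<Longrightarrow> m' rBest = m rBest \<Longrightarrow> m' rLen = m rLen \<Longrightarrow> stored m'"
  by (simp add: stored_def)

lemma s_le: "length s \<le> N"
  using length_less[OF s_in] by simp

lemma select_word_correct:
  assumes "stored m" and mask: "holds_mask (length s) x (m rMask)"
  shows "wp N select_word (\<lambda>m' out'. out' = out \<and>
    (\<forall>b. b \<notin> {rSize, rI, rWord} \<longrightarrow> m' b = m b) \<and>
    word_at m' rWord rSize = select x s) m out"
proof -
  let ?inv = "\<lambda>i m' out'. out' = out \<and> (\<forall>b. b \<notin> {rSize, rI, rWord} \<longrightarrow> m' b = m b) \<and>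
    word_at m' rWord rSize = map ((!) s) (filter (bit x) [0..<i])"
  show ?thesis
    unfolding select_word_def
    apply (simp only: wp_Put_Seq)
    apply (rule wp_For[where I = ?inv and n = "length s"])
    subgoal by (rule s_le)
    subgoal using assms by (simp add: stored_def)
    subgoal by (simp add: word_at_def)
    subgoal premises prems for i m1 out1
    proof -
      have "m1 rMask i = (if bit x i then 1 else 0)"
        using prems mask by (simp add: holds_mask_def)
      moreover have "m1 rInput (best + 1 + i) = s ! i"
        using prems assms s_chars by (simp add: stored_def)
      moreover have "m1 rBest 0 = best"
        using prems assms by (simp add: stored_def)
      ultimately show ?thesis
        using prems by (auto simp add: wp_Put_Seq wp_Put word_at_def)
    qed
    subgoal by (simp add: select_def)
    done
qed

lemma canonical_test_correct:
  assumes "stored m" and mask: "holds_mask (length s) x (m rMask)"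
    and word: "word_at m rWord rSize = select x s"
  shows "wp N canonical_test (\<lambda>m' out'. out' = out \<and>
    (\<forall>b. b \<notin> {rGood, rMatch, rI, rTmp} \<longrightarrow> m' b = m b) \<and>
    m' rGood 0 = (if canonical x s then 1 else 0)) m out"
proof -
  define w where "w = select x s"
  let ?inv = "\<lambda>i m' out'. out' = out \<and> (\<forall>b. b \<notin> {rGood, rMatch, rI, rTmp} \<longrightarrow> m' b = m b) \<and>
    m' rMatch 0 = matched w (take i s) \<and>
    m' rGood 0 = (if \<forall>j<i. bit x j = greedy w s j then 1 else 0)"
  show ?thesis
    unfolding canonical_test_def
    apply (simp only: wp_Put_Seq)
    apply (rule wp_For[where I = ?inv and n = "length s"])
    subgoal by (rule s_le)
    subgoal using assms by (simp add: stored_def)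
    subgoal by simp
    subgoal premises prems for i m1 out1
    proof -
      have "m1 rMask i = (if bit x i then 1 else 0)"
        using prems mask by (simp add: holds_mask_def)
      moreover have "m1 rInput (best + 1 + i) = s ! i"
        using prems assms s_chars by (simp add: stored_def)
      moreover have "m1 rBest 0 = best"
        using prems assms by (simp add: stored_def)
      moreover have "m1 rWord = m rWord" "m1 rSize = m rSize"
        using prems by auto
      moreover have "greedy w s i \<longleftrightarrow>
          matched w (take i s) < m rSize 0 \<and> m rWord (matched w (take i s)) = s ! i"
        unfolding greedy_def w_def word[symmetric] by auto
      ultimately show ?thesis
        using prems
        by (auto simp add: wp_Put_Seq wp_Put matched_take_Suc less_Suc_eq)
    qed
    subgoal by (simp add: canonical_def w_def)
    done
qed

lemma insert_word_correct:
  assumes "stored m" and word: "word_at m rWord rSize = w" "length w < N"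
    and g: "m rGap 0 \<le> length w" and j: "m rChar 0 < length s"
  shows "wp N insert_word (\<lambda>m' out'. out' = out \<and>
    (\<forall>b. b \<notin> {rI, rWord', rSize'} \<longrightarrow> m' b = m b) \<and>
    word_at m' rWord' rSize' = insert_char (m rGap 0) (s ! m rChar 0) w) m out"
proof -
  have size: "m rSize 0 = length w" and w: "\<And>i. i < length w \<Longrightarrow> w ! i = m rWord i"
    using word by auto
  \<comment> \<open>Target of character \<open>q\<close>: shifted by one from the gap on. The gap
    itself is never a target and is filled after the loop.\<close>
  let ?pos = "\<lambda>q. q + (if m rGap 0 < Suc q then 1 else 0)"
  let ?inv = "\<lambda>i m' out'. out' = out \<and> (\<forall>b. b \<notin> {rI, rWord'} \<longrightarrow> m' b = m b) \<and>
    (\<forall>q<i. m' rWord' (?pos q) = m rWord q)"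
  show ?thesis
    unfolding insert_word_def
    apply (rule wp_Seq)
    apply (rule wp_For[where I = ?inv and n = "length w"])
    subgoal using word by simp
    subgoal using size by simp
    subgoal by simp
    subgoal by (auto simp: wp_Put less_Suc_eq)
    subgoal premises prems for m1 out1
    proof -
      have stored: "\<forall>q<length w. m1 rWord' (?pos q) = m rWord q"
        using prems by blast
      have "m1 rInput (best + 1 + m rChar 0) = s ! m rChar 0" "m1 rBest 0 = best"
        using prems assms s_chars by (simp_all add: stored_def)
      moreover have "map ((m1 rWord')(m rGap 0 := s ! m rChar 0)) [0..<Suc (length w)]
          = insert_char (m rGap 0) (s ! m rChar 0) w"
      proof (rule nth_equalityI)
        fix i assume "i < length (map ((m1 rWord')(m rGap 0 := s ! m rChar 0)) [0..<Suc (length w)])"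
        then have i: "i \<le> length w" by simp
        consider "i < m rGap 0" | "i = m rGap 0" | k where "i = Suc k" "m rGap 0 \<le> k"
          by (metis less_Suc_eq_le linorder_neqE_nat not0_implies_Suc not_less0)
        then show "map ((m1 rWord')(m rGap 0 := s ! m rChar 0)) [0..<Suc (length w)] ! i
            = insert_char (m rGap 0) (s ! m rChar 0) w ! i"
        proof cases
          case 1
          with g have "i < length w" by simp
          with stored have "m1 rWord' (?pos i) = m rWord i" by blast
          with 1 \<open>i < length w\<close> g w show ?thesis
            by (simp add: insert_char_def nth_append del: upt_Suc)
        next
          case 2
          with i g show ?thesis
            by (simp add: insert_char_def nth_append del: upt_Suc)
        next
          case 3
          with i have "k < length w" by simp
          with stored have "m1 rWord' (?pos k) = m rWord k" by blast
          with 3 \<open>k < length w\<close> g w show ?thesis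
            by (simp add: insert_char_def nth_append del: upt_Suc)
        qed
      qed (use g in \<open>simp add: length_insert_char\<close>)
      ultimately show ?thesis
        using prems size by (simp add: wp_Put_Seq wp_Put word_at_def del: upt_Suc)
    qed
    done
qed

text \<open>\<open>G\<close> stands for the verdict of the earlier tests. Both loops run to the end
  and only ever lower the flag, so their invariants are conjunctions over the pairs visited so
  far.\<close>

lemma maximal_test_correct:
  assumes "stored m" and word: "word_at m rWord rSize = w" "length w < N"
    and good: "m rGood 0 = (if G then 1 else 0)"
  shows "wp N maximal_test (\<lambda>m' out'. out' = out \<and>
    (\<forall>b. b \<notin> {rPos, rI, rJ, rMatch, rFlag, rWord', rSize', rGood, rGap, rChar} \<longrightarrow> m' b = m b) \<and>
    m' rGood 0 = (if G \<and> (\<forall>g\<le>length w. \<forall>j<length s.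
      insert_char g (s ! j) w \<notin> common_subseqs (set ss)) then 1 else 0)) m out"
proof -
  have size: "m rSize 0 = length w"
    using word by auto
  let ?frame = "\<lambda>m'. \<forall>b. b \<notin> {rPos, rI, rJ, rMatch, rFlag, rWord', rSize', rGood, rGap, rChar}
    \<longrightarrow> m' b = m b"
  let ?bad = "\<lambda>g j. insert_char g (s ! j) w \<in> common_subseqs (set ss)"
  let ?inv = "\<lambda>g m' out'. out' = out \<and> ?frame m' \<and>
    m' rGood 0 = (if G \<and> (\<forall>g'<g. \<forall>j<length s. \<not> ?bad g' j) then 1 else 0)"
  show ?thesis
    unfolding maximal_test_def
    apply (rule wp_For[where I = ?inv and n = "Suc (length w)"])
    subgoal using word by simp
    subgoal using size by simp
    subgoal using good by simp
    subgoal premises gap for g m1 out1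
    proof -
      let ?inv' = "\<lambda>i m' out'. out' = out \<and> ?frame m' \<and> m' rGap 0 = g \<and>
        m' rGood 0 = (if G \<and> (\<forall>g'<g. \<forall>j<length s. \<not> ?bad g' j) \<and> (\<forall>j<i. \<not> ?bad g j)
          then 1 else 0)"
      show ?thesis
        apply (rule wp_For[where I = ?inv' and n = "length s"])
        subgoal by (rule s_le)
        subgoal using assms by (simp add: stored_def)
        subgoal using gap by simp
        subgoal premises char for i m2 out2
        proof -
          have stored2: "stored m2"
            using \<open>stored m\<close> char by (auto intro: stored_cong)
          have word2: "word_at m2 rWord rSize = w"
            using char word by (simp add: word_at_def)
          show ?thesis
            apply (rule wp_Seq)
            apply (rule wp_conseq[OF insert_word_correct[OF stored2 word2]])
            subgoal by (rule word)
            subgoal using gap char by simp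
            subgoal using char by simp
            subgoal premises ins for m3 out3
            proof -
              have "holds_instance ss (m3 rInput)"
                using stored2 ins inst by (simp add: stored_def)
              moreover have "length s \<le> N" if "s \<in> set ss" for s
                using length_less[OF that] by simp
              ultimately show ?thesis
                apply (intro wp_Seq)
                apply (rule wp_conseq[OF common_test_correct[OF _ ss_le]])
                apply assumption
                subgoal by simp
                subgoal by simp
                subgoal by simp
                subgoal premises common for m4 out4
                proof -
                  have "m4 rGood 0 = m2 rGood 0" "m4 rGap 0 = g" "m4 rChar 0 = i"
                    using common ins char by simp_all
                  moreover have "m4 rFlag 0 = (if ?bad g i then 1 else 0)"
                    using common ins char by simp
                  moreover have "?frame m4"
                    using common ins char by simp
                  ultimately show ?thesis
                    using common ins char by (simp add: wp_Put less_Suc_eq)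
                qed
                done
            qed
            done
        qed
        subgoal by (auto simp: less_Suc_eq)
        done
    qed
    subgoal by (simp add: less_Suc_eq_le)
    done
qed

lemma enumerate_step_correct:
  assumes "stored m" and mask: "holds_mask (length s) x (m rMask)"
  shows "wp N enumerate_step (\<lambda>m' out'. stored m' \<and> holds_mask (length s) (Suc x) (m' rMask) \<and>
    m' rCount = m rCount \<and> m' rPow = m rPow \<and>
    out' = out @ (if solution (set ss) s x then encode_strs [select x s] else [])) m out"
proof -
  define w where "w = select x s"
  have len: "length w < N"
    using length_select_le[of x s] length_less[OF s_in] by (simp add: w_def)
  have len_le: "length s \<le> N" if "s \<in> set ss" for s
    using length_less[OF that] by simp
  show ?thesis
    unfolding enumerate_step_def
    apply (rule wp_Seq)
    apply (rule wp_conseq[OF select_word_correct[OF assms]])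
    subgoal premises sel for m1 out1
    proof -
      have stored1: "stored m1" and mask1: "holds_mask (length s) x (m1 rMask)"
        and word1: "word_at m1 rWord rSize = w"
        using sel assms by (auto simp: w_def intro: stored_cong)
      show ?thesis
        apply (rule wp_Seq)
        apply (rule wp_conseq[OF canonical_test_correct[OF stored1 mask1]])
        subgoal using word1 by (simp add: w_def)
        subgoal premises canon for m2 out2
        proof -
          have "holds_instance ss (m2 rInput)"
            using stored1 inst canon by (simp add: stored_def)
          then show ?thesis
            apply (intro wp_Seq)
            apply (rule wp_conseq[OF common_test_correct[OF _ ss_le len_le]])
            apply assumption+
            subgoal by simp
            subgoal by simp
            subgoal premises common for m3 out3
            proof -
              let ?m = "m3(rGood := (m3 rGood)(0 :=
                (if canonical x s \<and> w \<in> common_subseqs (set ss) then 1 else 0)))"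
              have word: "word_at m2 rWord rSize = w"
                using word1 canon by (simp add: word_at_def)
              have stored3: "stored ?m"
                using stored1 common canon by (auto intro: stored_cong)
              have word3: "word_at ?m rWord rSize = w"
                using word common by (simp add: word_at_def)
              have good3: "?m rGood 0 =
                  (if canonical x s \<and> w \<in> common_subseqs (set ss) then 1 else 0)"
                by simp
              have good: "m3(rGood := (m3 rGood)(eval m3 (Num 0) :=
                  eval m3 (Both (Reg rGood) (Reg rFlag)))) = ?m"
                using canon common word by simp
              show ?thesis
                unfolding wp_Put_Seq good
                apply (rule wp_Seq)
                apply (rule wp_conseq[OF maximal_test_correct[OF stored3 word3 len good3]])
                subgoal premises max for m4 out4
                proof -
                  \<comment> \<open>Canonical, common, and not extendable by one insertion: this is
                    \<open>solution\<close> by \<open>MCS_iff_insert_char\<close>.\<close>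
                  have good4: "m4 rGood 0 = (if solution (set ss) s x then 1 else 0)"
                    using max MCS_iff_insert_char[OF s_in, of w]
                    by (auto simp: solution_def w_def)
                  have word4: "word_at m4 rWord rSize = w"
                    using max word3 by (simp add: word_at_def)
                  then have size4: "m4 rSize 0 = length w"
                    by (metis length_word_at)
                  have stored4: "stored m4"
                    using stored3 max by (auto intro: stored_cong)
                  have mask4: "holds_mask (length s) x (m4 rMask)"
                    using mask1 canon common max by simp
                  have out4: "out4 = out"
                    using sel canon common max by simp
                  have same4: "m4 rCount = m rCount" "m4 rPow = m rPow"
                    using sel canon common max by simp_all
                  show ?thesis
                    apply (rule wp_Seq)
                    apply (rule wp_conseq[OF output_word_correct[
                      where m = m4 and G = "solution (set ss) s x", OF good4]])
                    subgoal using size4 len by simp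
                    subgoal premises out for m5 out5
                    proof -
                      have stored5: "stored m5"
                        using stored4 out by (auto intro: stored_cong)
                      then have "m5 rLen 0 = length s" by (simp add: stored_def)
                      moreover have "holds_mask (length s) x (m5 rMask)"
                        using mask4 out by simp
                      ultimately show ?thesis
                        apply (intro wp_conseq[OF next_mask_correct[of m5 x]])
                        subgoal by simp
                        subgoal using s_le by simp
                        subgoal premises nxt for m6 out6
                        proof -
                          have "stored m6"
                            using stored5 nxt by (auto intro: stored_cong)
                          moreover have "out6 =
                              out @ (if solution (set ss) s x then length w # w else [])"
                            using nxt out out4 size4 word4 by simp
                          ultimately show ?thesis
                            using nxt out same4 by (simp add: w_def encode_strs_def)
                        qed
                        done
                    qed
                    done
                qed
                done
            qed
            done
        qed
        done
    qed
    done
qed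

end

section \<open>Running time\<close>

lemma encode_strs_filter_Suc:
  "encode_strs (map f (filter P [0..<Suc x])) =
    encode_strs (map f (filter P [0..<x])) @ (if P x then encode_strs [f x] else [])"
  by (simp add: encode_strs_def)

lemma enumerate_MCS_correct:
  assumes "distinct ss" "ss \<noteq> []" and N: "N = length (encode_instance ss)"
  shows "\<exists>t ws. runs enumerate_MCS (encode_instance ss) t (encode_strs ws) \<and>
    t \<le> 2 ^ min_len (set ss) * (loop_cost N enumerate_MCS + loop_cost N enumerate_step + 21) \<and>
    distinct ws \<and> set ws = MCS (set ss)"
proof -
  let ?init = "Seq find_shortest (power_two rI rLen rPow)"
  let ?m = "initial_memory (encode_instance ss)"
  let ?l = "min_len (set ss)"
  \<comment> \<open>The shortest string is found at run time and depends on the listing, so it stays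
    existential; any choice yields the same set of words.\<close>
  let ?Q = "\<lambda>m' out'. \<exists>s\<in>set ss.
    out' = encode_strs (map (\<lambda>x. select x s) (filter (solution (set ss) s) [0..<2 ^ length s]))"
  \<comment> \<open>As \<open>cost (Reg rPow) = 2\<close>, the constants 10 and 7 of
    \<open>wpT_For\<close> become 12 and 9, with sum 21.\<close>
  let ?T = "2 ^ ?l * (12 + loop_cost N enumerate_step) + 9"
  have N_eq: "N = 1 + length ss + sum_list (map length ss)"
    by (simp add: N encode_instance_def length_encode_strs)
  have k_le: "length ss \<le> N"
    by (simp add: N_eq)
  have length_less: "length s < N" if "s \<in> set ss" for s
    using member_le_sum_list[of "length s" "map length ss"] that by (simp add: N_eq)
  have "wp N ?init (wpT ?T (For rCount (Reg rPow) enumerate_step) ?Q) ?m []"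
    apply (rule wp_Seq)
    apply (rule wp_conseq[OF find_shortest_correct[where m = ?m and ss = ss,
      OF holds_instance_initial \<open>ss \<noteq> []\<close> k_le]])
    subgoal premises find for m1 out1
    proof -
      obtain i0 where i0: "i0 < length ss" "m1 rBest 0 = offset ss i0"
          "m1 rLen 0 = length (ss ! i0)" "\<forall>i<length ss. length (ss ! i0) \<le> length (ss ! i)"
        using find by blast
      define s where "s = ss ! i0"
      have s: "s \<in> set ss" "m1 rLen 0 = length s"
        using i0 by (simp_all add: s_def)
      have "Min (length ` set ss) = length s"
        using i0(4) s(1) by (intro Min_eqI) (auto simp: s_def in_set_conv_nth)
      then have l: "?l = length s"
        by (simp add: min_len_def)
      interpret MCS_instance ss "?m rInput" s "offset ss i0" N
        using holds_instance_initial[of ss] i0(1) s(1) k_le length_less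
        by unfold_locales (auto simp: holds_instance_def s_def)
      show ?thesis
        apply (rule wp_conseq[OF power_two_correct])
        subgoal using s s_le by simp
        subgoal by simp
        subgoal premises pow for m2 out2
        proof -
          have stored2: "stored m2"
            using find i0 pow s by (auto simp: stored_def)
          have mask2: "holds_mask (length s) 0 (m2 rMask)"
            using find pow by (simp add: holds_mask_def initial_memory_def)
          let ?inv = "\<lambda>x m' out'. stored m' \<and> holds_mask (length s) x (m' rMask) \<and>
            m' rPow 0 = 2 ^ length s \<and>
            out' = encode_strs (map (\<lambda>x. select x s) (filter (solution (set ss) s) [0..<x]))"
          have "wpT (2 ^ length s * (cost (Reg rPow) + 10 + loop_cost N enumerate_step)
              + cost (Reg rPow) + 7) (For rCount (Reg rPow) enumerate_step) ?Q m2 out2"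
            apply (rule wpT_For[where I = ?inv and n = "2 ^ length s"])
            subgoal by simp
            subgoal using stored2 mask2 pow find s
              by (auto simp: encode_strs_def intro: stored_cong)
            subgoal premises x for x m3 out3
              apply (rule wp_conseq[OF enumerate_step_correct[of m3 x]])
              subgoal using x by simp
              subgoal using x by simp
              subgoal for m4 out4
                using x unfolding encode_strs_filter_Suc by (auto intro: stored_cong)
              done
            subgoal using s(1) by blast
            done
          then show ?thesis
            by (simp add: l add_ac)
        qed
        done
    qed
    done
  then have "wpT (loop_cost N ?init + ?T) enumerate_MCS ?Q ?m []"
    unfolding enumerate_MCS_def wp_def by (rule wpT_Seq)
  then obtain t m' s where t: "exec enumerate_MCS (?m, []) t (m', encode_strs
      (map (\<lambda>x. select x s) (filter (solution (set ss) s) [0..<2 ^ length s])))"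
      "t \<le> loop_cost N ?init + ?T" "s \<in> set ss"
    unfolding wpT_def by blast
  \<comment> \<open>As \<open>2 ^ ?l\<close> is at least 1, it can be multiplied onto the terms
    outside the loop.\<close>
  have "loop_cost N ?init + ?T \<le> 2 ^ ?l * loop_cost N ?init + ?T"
    by simp
  also have "\<dots> \<le> 2 ^ ?l * loop_cost N ?init +
      (2 ^ ?l * (12 + loop_cost N enumerate_step) + 2 ^ ?l * 9)"
    by simp
  also have "\<dots> \<le> 2 ^ ?l * (loop_cost N enumerate_MCS + loop_cost N enumerate_step + 21)"
    by (simp add: enumerate_MCS_def algebra_simps)
  finally show ?thesis
    using t solutions_distinct[of s "set ss"] solutions_MCS[OF t(3)]
    unfolding runs_def by (meson order_trans)
qed

text \<open>The base \<open>x + 1\<close> is at least 1 even at \<open>x = 0\<close>, so its highest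
  power absorbs the lower ones.\<close>

lemma poly_nat_le_power: "\<exists>A B. \<forall>x. poly p x \<le> A * (x + 1) ^ B" for p :: "nat poly"
proof (induction p)
  case 0
  show ?case by simp
next
  case (pCons a p)
  then obtain A B where AB: "\<And>x. poly p x \<le> A * (x + 1) ^ B" by blast
  have "poly (pCons a p) x \<le> (a + A) * (x + 1) ^ Suc B" for x
  proof -
    have "poly (pCons a p) x \<le> a + (x + 1) * (A * (x + 1) ^ B)"
      using mult_le_mono[OF _ AB[of x], of x "x + 1"] by simp
    moreover have "1 \<le> (x + 1) ^ Suc B"
      by (rule one_le_power) simp
    from mult_le_mono2[OF this, of a] have "a \<le> a * (x + 1) ^ Suc B"
      by (simp only: mult_1_right)
    ultimately have "poly (pCons a p) x \<le> a * (x + 1) ^ Suc B + (x + 1) * (A * (x + 1) ^ B)"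
      by linarith
    then show ?thesis
      by (simp only: power_Suc add_mult_distrib mult.left_commute)
  qed
  then show ?case by blast
qed

lemma total_len_set: "distinct ss \<Longrightarrow> total_len (set ss) = sum_list (map length ss)"
  by (simp add: total_len_def sum_list_distinct_conv_sum_set)

text \<open>Only the empty string contributes no length, and a set contains it at most once.\<close>

lemma card_le_total_len:
  assumes "finite S"
  shows "card S \<le> total_len S + 1"
proof -
  have "card (S - {[]}) = (\<Sum>s\<in>S - {[]}. 1)"
    by simp
  also have "\<dots> \<le> (\<Sum>s\<in>S - {[]}. length s)"
    by (intro sum_mono) (auto simp: Suc_le_eq)
  also have "\<dots> \<le> total_len S"
    unfolding total_len_def using assms by (intro sum_mono2) auto
  finally have "card (S - {[]}) \<le> total_len S" .
  moreover have "card S \<le> card (S - {[]}) + 1"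
    unfolding card_Diff_singleton_if by (split if_split) linarith
  ultimately show ?thesis by simp
qed

lemma enumerate_MCS_within:
  "\<exists>A B. \<forall>S. finite S \<and> S \<noteq> {} \<longrightarrow> enumerates_MCS_within enumerate_MCS S
    (real (2 ^ min_len S * (A * (total_len S + 1) ^ B)))"
proof -
  obtain p where "\<And>N. loop_cost N enumerate_MCS = poly p N"
    using loop_cost_poly by blast
  moreover obtain q where "\<And>N. loop_cost N enumerate_step = poly q N"
    using loop_cost_poly by blast
  ultimately obtain A B where AB:
      "\<And>N. loop_cost N enumerate_MCS + loop_cost N enumerate_step + 21 \<le> A * (N + 1) ^ B"
    using poly_nat_le_power[of "p + q + [:21:]"] by auto
  have "enumerates_MCS_within enumerate_MCS S
      (real (2 ^ min_len S * (A * 3 ^ B * (total_len S + 1) ^ B)))"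
    if "finite S" "S \<noteq> {}" for S
    unfolding enumerates_MCS_within_def
  proof (intro allI impI)
    fix ss
    assume ss: "distinct ss \<and> set ss = S"
    define N where "N = length (encode_instance ss)"
    have "N = 1 + card S + total_len S"
      using ss by (auto simp: N_def encode_instance_def length_encode_strs total_len_set distinct_card)
    \<comment> \<open>With t the total length, \<open>card S\<close> is at most t + 1, so N + 1 is
      at most 2 t + 3.\<close>
    then have "N + 1 \<le> 3 * (total_len S + 1)"
      using card_le_total_len[OF \<open>finite S\<close>] by simp
    then have "A * (N + 1) ^ B \<le> A * (3 * (total_len S + 1)) ^ B"
      by (intro mult_le_mono2 power_mono) simp_all
    then have bound: "loop_cost N enumerate_MCS + loop_cost N enumerate_step + 21
        \<le> A * 3 ^ B * (total_len S + 1) ^ B"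
      using AB[of N] by (simp only: power_mult_distrib mult.assoc)
    obtain t ws where t: "runs enumerate_MCS (encode_instance ss) t (encode_strs ws)"
        "t \<le> 2 ^ min_len S * (loop_cost N enumerate_MCS + loop_cost N enumerate_step + 21)"
        "distinct ws" "set ws = MCS S"
      using enumerate_MCS_correct[OF _ _ N_def] ss \<open>S \<noteq> {}\<close> by blast
    have "t \<le> 2 ^ min_len S * (A * 3 ^ B * (total_len S + 1) ^ B)"
      using t(2) mult_le_mono2[OF bound] by (rule order_trans)
    then have "real t \<le> real (2 ^ min_len S * (A * 3 ^ B * (total_len S + 1) ^ B))"
      by (simp only: of_nat_le_iff)
    with t show "\<exists>t ws. runs enumerate_MCS (encode_instance ss) t (encode_strs ws) \<and>
        real t \<le> real (2 ^ min_len S * (A * 3 ^ B * (total_len S + 1) ^ B)) \<and>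
        distinct ws \<and> set ws = MCS S"
      by blast
  qed
  then show ?thesis by blast
qed

lemma enumerates_MCS_within_mono:
  "enumerates_MCS_within P S b \<Longrightarrow> b \<le> b' \<Longrightarrow> enumerates_MCS_within P S b'"
  unfolding enumerates_MCS_within_def by (fast intro: order_trans)

lemma computable_power_two: "computable (\<lambda>x. 2 ^ x)"
proof -
  have "\<exists>t. runs (Seq (power_two rI rInput rPow) (Out (Reg rPow))) [x] t [2 ^ x]" for x
  proof -
    let ?m = "initial_memory [x]"
    have "wp x (Seq (power_two rI rInput rPow) (Out (Reg rPow))) (\<lambda>m' out'. out' = [2 ^ x]) ?m []"
      by (intro wp_Seq wp_conseq[OF power_two_correct] wp_Out) (auto simp: initial_memory_def)
    then show ?thesis
      unfolding wp_def wpT_def runs_def by blast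
  qed
  then show ?thesis
    unfolding computable_def by blast
qed

section \<open>Parameter regimes\<close>

lemma total_len_le:
  assumes "finite S"
  shows "total_len S \<le> max_len S * card S"
proof -
  have "total_len S \<le> (\<Sum>s\<in>S. max_len S)"
    unfolding total_len_def max_len_def using assms by (intro sum_mono Max_ge) auto
  then show ?thesis by (simp add: mult.commute)
qed

text \<open>Rewrites \<open>2 powr (c * log 2 t)\<close> as a power of t. The absolute value and the
  ceiling give a natural exponent for every real \<open>c\<close>, and \<open>t + 1\<close> covers t
  = 0.\<close>

lemma two_power_le_if_log_bound:
  assumes "real l \<le> c * log 2 (real t)"
  shows "2 ^ l \<le> (t + 1) ^ nat \<lceil>\<bar>c\<bar>\<rceil>"
proof -
  let ?D = "nat \<lceil>\<bar>c\<bar>\<rceil>"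
  \<comment> \<open>At \<open>t = 0\<close> this rests on the default value
    \<open>log 2 0 = 0\<close>.\<close>
  have log: "0 \<le> log 2 (real t) \<and> log 2 (real t) \<le> log 2 (real (t + 1))"
    by (cases t) (simp_all add: log_def divide_right_mono)
  then have log_nonneg: "0 \<le> log 2 (real t)" by simp
  have "real l \<le> \<bar>c\<bar> * log 2 (real t)"
    using assms log_nonneg mult_right_mono[of c "\<bar>c\<bar>"] by fastforce
  also have "\<dots> \<le> real ?D * log 2 (real (t + 1))"
    using log by (intro mult_mono) linarith+
  finally have "2 powr real l \<le> 2 powr (real ?D * log 2 (real (t + 1)))"
    by simp
  also have "\<dots> = (2 powr log 2 (real (t + 1))) powr real ?D"
    by (simp only: powr_powr mult.commute)
  also have "\<dots> = real ((t + 1) ^ ?D)"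
    by (subst powr_realpow) simp_all
  finally show ?thesis
    by (simp add: powr_realpow flip: of_nat_le_iff[where 'a = real])
qed

text \<open>For t \<le> 1 the logarithm is 0, and so is its \<open>powr\<close>, even for negative
  \<open>d\<close>. Otherwise the logarithm is at least 1, so the exponent may be raised to a
  natural number.\<close>

lemma log_powr_le:
  assumes "t \<le> N\<^sup>2" "2 \<le> N"
  shows "log 2 (real t) powr d \<le> (2 * log 2 (real N)) ^ nat \<lceil>\<bar>d\<bar>\<rceil>"
proof (cases "t \<le> 1")
  case True
  then have "log 2 (real t) = 0"
    by (cases t) (auto simp: log_def)
  then show ?thesis
    using assms by simp
next
  case False
  let ?D = "nat \<lceil>\<bar>d\<bar>\<rceil>"
  have log_ge: "1 \<le> log 2 (real t)"
    using False by simp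
  have "log 2 (real t) \<le> log 2 (real (N\<^sup>2))"
    using assms False by (intro log_mono of_nat_mono) simp_all
  also have "\<dots> = 2 * log 2 (real N)"
    using assms by (simp add: log_nat_power)
  finally have log_le: "log 2 (real t) \<le> 2 * log 2 (real N)" .
  have "log 2 (real t) powr d \<le> log 2 (real t) powr real ?D"
    using log_ge by (intro powr_mono) linarith+
  also have "\<dots> = log 2 (real t) ^ ?D"
    using log_ge by (intro powr_realpow) simp
  also have "\<dots> \<le> (2 * log 2 (real N)) ^ ?D"
    using log_le log_ge by (intro power_mono) simp_all
  finally show ?thesis .
qed

lemma fpt_bound_le_polynomial:
  assumes "finite S" "real (min_len S) \<le> c * log 2 (real (total_len S))"
  shows "2 ^ min_len S * (A * (total_len S + 1) ^ B)
    \<le> A * (max_len S * card S + 1) ^ (nat \<lceil>\<bar>c\<bar>\<rceil> + B)"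
proof -
  have "2 ^ min_len S * (A * (total_len S + 1) ^ B)
      \<le> (total_len S + 1) ^ nat \<lceil>\<bar>c\<bar>\<rceil> * (A * (total_len S + 1) ^ B)"
    using two_power_le_if_log_bound[OF assms(2)] by (rule mult_le_mono1)
  also have "\<dots> = A * (total_len S + 1) ^ (nat \<lceil>\<bar>c\<bar>\<rceil> + B)"
    by (simp add: power_add)
  also have "\<dots> \<le> A * (max_len S * card S + 1) ^ (nat \<lceil>\<bar>c\<bar>\<rceil> + B)"
    using total_len_le[OF assms(1)] by (intro mult_le_mono2 power_mono) simp_all
  finally show ?thesis .
qed

lemma fpt_bound_le_quasipolynomial:
  fixes c d :: real
  defines "D \<equiv> nat \<lceil>\<bar>d\<bar>\<rceil>"
  assumes S: "finite S" "S \<noteq> {}"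
    and l: "real (min_len S) \<le> c * log 2 (real (total_len S)) powr d"
    and N: "N = max_len S + card S"
  shows "real (2 ^ min_len S * (A * (total_len S + 1) ^ B))
    \<le> real A * real N powr (real (2 * B) + \<bar>c\<bar> * (2 * log 2 (real N)) ^ D)"
proof -
  have card: "1 \<le> card S"
    using S by (simp add: Suc_le_eq card_gt_0_iff)
  \<comment> \<open>With n the maximal length and k \<ge> 1 strings, n k + 1 \<le> n k + k k \<le>
    (n + k) (n + k).\<close>
  have total: "total_len S + 1 \<le> N\<^sup>2"
  proof -
    have "total_len S + 1 \<le> max_len S * card S + card S * card S"
      using total_len_le[OF S(1)] mult_le_mono[OF card card] by linarith
    also have "\<dots> \<le> N\<^sup>2"
      unfolding N by (simp add: power2_eq_square algebra_simps)
    finally show ?thesis .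
  qed
  have N_pos: "1 \<le> N"
    using card N by simp
  have two: "2 ^ min_len S \<le> real N powr (\<bar>c\<bar> * (2 * log 2 (real N)) ^ D)"
  proof (cases "2 \<le> N")
    case True
    have "real (min_len S) \<le> \<bar>c\<bar> * log 2 (real (total_len S)) powr d"
      by (rule order_trans[OF l]) (simp add: mult_right_mono)
    also have "\<dots> \<le> \<bar>c\<bar> * (2 * log 2 (real N)) ^ D"
      unfolding D_def using total True by (intro mult_left_mono log_powr_le) simp_all
    finally have exponent: "real (min_len S) \<le> \<bar>c\<bar> * (2 * log 2 (real N)) ^ D" .
    \<comment> \<open>Raising the base from 2 to \<open>N\<close> is wasteful but leaves a
      polynomial in \<open>log 2 N\<close> as exponent.\<close>
    have "2 ^ min_len S \<le> real N ^ min_len S"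
      using True by (intro power_mono) simp_all
    also have "\<dots> = real N powr real (min_len S)"
      using True by (simp add: powr_realpow)
    also have "\<dots> \<le> real N powr (\<bar>c\<bar> * (2 * log 2 (real N)) ^ D)"
      using True exponent by (intro powr_mono) simp_all
    finally show ?thesis .
  next
    \<comment> \<open>Here \<open>S\<close> consists of the empty string alone, so the hypothesis on
      \<open>min_len S\<close> forces it to be 0.\<close>
    case False
    with N_pos have "N = 1" by simp
    with total have "total_len S = 0" by simp
    with l have "min_len S = 0" by (simp add: log_def)
    with \<open>N = 1\<close> show ?thesis by simp
  qed
  have "real ((total_len S + 1) ^ B) \<le> real ((N\<^sup>2) ^ B)"
    unfolding of_nat_le_iff using total by (intro power_mono) simp_all
  also have "\<dots> = real N powr real (2 * B)"
    using N_pos powr_realpow[of "real N" "2 * B"] by (simp add: power_mult)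
  finally have total_pow: "real ((total_len S + 1) ^ B) \<le> real N powr real (2 * B)" .
  have "real (2 ^ min_len S * (A * (total_len S + 1) ^ B))
      = real A * (real ((total_len S + 1) ^ B) * 2 ^ min_len S)"
    by simp
  also have "\<dots> \<le> real A * (real N powr real (2 * B) *
      real N powr (\<bar>c\<bar> * (2 * log 2 (real N)) ^ D))"
    using total_pow two by (intro mult_left_mono mult_mono) simp_all
  finally show ?thesis
    by (simp only: powr_add)
qed

theorem theorem3:
  shows "\<exists>P.
    (\<exists>(f :: nat \<Rightarrow> nat) (p :: nat poly). computable f \<and>
      (\<forall>S. finite S \<and> S \<noteq> {} \<longrightarrow>
        enumerates_MCS_within P S (real (f (min_len S) * poly p (total_len S))))) \<and>
    (\<forall>c :: real. \<exists>p :: nat poly poly.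
      (\<forall>S. finite S \<and> S \<noteq> {} \<and> real (min_len S) \<le> c * log 2 (real (total_len S)) \<longrightarrow>
        enumerates_MCS_within P S (real (poly (poly p [:card S:]) (max_len S))))) \<and>
    (\<forall>(c :: real) (d :: real). \<exists>(C :: real) (q :: real poly).
      (\<forall>S. finite S \<and> S \<noteq> {} \<and>
          real (min_len S) \<le> c * log 2 (real (total_len S)) powr d \<longrightarrow>
        enumerates_MCS_within P S
          (let N = real (max_len S + card S) in C * N powr poly q (log 2 N))))"
proof -
  obtain A B where AB: "\<And>S. finite S \<Longrightarrow> S \<noteq> {} \<Longrightarrow>
      enumerates_MCS_within enumerate_MCS S (real (2 ^ min_len S * (A * (total_len S + 1) ^ B)))"
    using enumerate_MCS_within by blast
  show ?thesis
  proof (intro exI[of _ enumerate_MCS] conjI allI)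
    have "poly ([:A:] * [:1, 1:] ^ B) t = A * (t + 1) ^ B" for t
      by (simp add: poly_power add.commute)
    with AB computable_power_two
    show "\<exists>(f :: nat \<Rightarrow> nat) (p :: nat poly). computable f \<and>
      (\<forall>S. finite S \<and> S \<noteq> {} \<longrightarrow>
        enumerates_MCS_within enumerate_MCS S (real (f (min_len S) * poly p (total_len S))))"
      by (intro exI[of _ "\<lambda>x. 2 ^ x"] exI[of _ "[:A:] * [:1, 1:] ^ B"]) metis
  next
    fix c :: real
    \<comment> \<open>The outer variable stands for the number k of strings and the inner one for
      the maximal length n; the base of the power is 1 + n k.\<close>
    let ?p = "[:[:A:]:] * [:1, [:0, 1:]:] ^ (nat \<lceil>\<bar>c\<bar>\<rceil> + B) :: nat poly poly"
    have p: "poly (poly ?p [:k:]) n = A * (n * k + 1) ^ (nat \<lceil>\<bar>c\<bar>\<rceil> + B)" for k n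
      by (simp add: poly_power add.commute mult.commute)
    show "\<exists>p :: nat poly poly.
      (\<forall>S. finite S \<and> S \<noteq> {} \<and> real (min_len S) \<le> c * log 2 (real (total_len S)) \<longrightarrow>
        enumerates_MCS_within enumerate_MCS S (real (poly (poly p [:card S:]) (max_len S))))"
    proof (intro exI[of _ ?p] allI impI; elim conjE)
      fix S :: "str set"
      assume "finite S" "S \<noteq> {}" "real (min_len S) \<le> c * log 2 (real (total_len S))"
      then show "enumerates_MCS_within enumerate_MCS S
          (real (poly (poly ?p [:card S:]) (max_len S)))"
        unfolding p
        by (intro enumerates_MCS_within_mono[OF AB] of_nat_mono fpt_bound_le_polynomial)
    qed
  next
    fix c d :: real
    let ?D = "nat \<lceil>\<bar>d\<bar>\<rceil>"
    \<comment> \<open>The constant \<open>2 * B\<close> comes from the polynomial factor, the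
      monomial from the bound on \<open>2 ^ l\<close>.\<close>
    let ?q = "[:real (2 * B):] + monom (\<bar>c\<bar> * 2 ^ ?D) ?D"
    have q: "poly ?q x = real (2 * B) + \<bar>c\<bar> * (2 * x) ^ ?D" for x
      by (simp add: poly_monom power_mult_distrib)
    show "\<exists>(C :: real) (q :: real poly).
      (\<forall>S. finite S \<and> S \<noteq> {} \<and>
          real (min_len S) \<le> c * log 2 (real (total_len S)) powr d \<longrightarrow>
        enumerates_MCS_within enumerate_MCS S
          (let N = real (max_len S + card S) in C * N powr poly q (log 2 N)))"
    proof (intro exI[of _ "real A"] exI[of _ ?q] allI impI; elim conjE)
      fix S :: "str set"
      assume "finite S" "S \<noteq> {}"
        "real (min_len S) \<le> c * log 2 (real (total_len S)) powr d"
      then show "enumerates_MCS_within enumerate_MCS S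
          (let N = real (max_len S + card S) in real A * N powr poly ?q (log 2 N))"
        unfolding q Let_def
        by (intro enumerates_MCS_within_mono[OF AB] fpt_bound_le_quasipolynomial refl)
    qed
  qed
qed

end
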